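(* Let $J_4$ be the 3-graph on vertex set $[5]$ whose edges are all triples $\{x,y,5\}$ with $\{x,y\}\subseteq[4]$, $x\neq y$, and let $F_{3,2}=([5],\{123,124,125,345\})$. Then \[\pi(J_4, F_{3,2}) = \frac{3}{8}.\]
   Context: A 3-graph $G=(V,E)$ consists of a vertex set $V$ and a set $E$ of 3-element subsets of $V$ (edges); $xyz$ abbreviates $\{x,y,z\}$. For a family $\mathcal{F}$ of 3-graphs, $G$ is $\mathcal{F}$-free if it contains no member of $\mathcal{F}$ as a (not necessarily induced) subgraph. $\mathrm{ex}(n,\mathcal{F})$ is the maximum number of edges of an $\mathcal{F}$-free 3-graph on $n$ vertices, and the Turán density is $\pi(\mathcal{F})=\lim_{n\to\infty}\mathrm{ex}(n,\mathcal{F})/\binom{n}{3}$ (this limit exists). $\pi(H_1,\dots,H_k)$ means $\pi(\{H_1,\dots,H_k\})$. *)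

theory Defs
  imports "HOL-Analysis.Analysis" "HOL-Library.Ramsey"
begin

text \<open>A 3-graph is a pair \<open>(V, E)\<close> of a vertex set and a set of 3-element subsets of \<open>V\<close>.\<close>

type_synonym 'a hgraph = "'a set \<times> 'a set set"

abbreviation verts :: "'a hgraph \<Rightarrow> 'a set" where "verts \<equiv> fst"
abbreviation edges :: "'a hgraph \<Rightarrow> 'a set set" where "edges \<equiv> snd"

definition three_graph :: "'a hgraph \<Rightarrow> bool" where
  "three_graph G \<longleftrightarrow> edges G \<subseteq> nsets (verts G) 3"

text \<open>\<open>H\<close> is, up to renaming of its vertices, a not necessarily induced subgraph of \<open>G\<close>.\<close>

definition contains_copy :: "'a hgraph \<Rightarrow> 'b hgraph \<Rightarrow> bool" where
  "contains_copy G H \<longleftrightarrow>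
     (\<exists>f. inj_on f (verts H) \<and> f ` verts H \<subseteq> verts G \<and> (\<forall>e\<in>edges H. f ` e \<in> edges G))"

definition free_of :: "'b hgraph set \<Rightarrow> 'a hgraph \<Rightarrow> bool" where
  "free_of \<F> G \<longleftrightarrow> (\<forall>H\<in>\<F>. \<not> contains_copy G H)"

text \<open>
  Every 3-graph on \<open>n\<close> vertices has an isomorphic copy with natural numbers as vertices, so it
  suffices to let \<open>G\<close> range over these. The maximum is over a finite set, which is nonempty
  as soon as every member of \<open>\<F>\<close> has an edge.
\<close>

definition turan_ex :: "nat \<Rightarrow> 'b hgraph set \<Rightarrow> nat" where
  "turan_ex n \<F> = Max {card (edges G) | G :: nat hgraph.
     three_graph G \<and> finite (verts G) \<and> card (verts G) = n \<and> free_of \<F> G}"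

definition turan_density :: "'b hgraph set \<Rightarrow> real" where
  "turan_density \<F> = lim (\<lambda>n. real (turan_ex n \<F>) / real (n choose 3))"

definition J4 :: "nat hgraph" where
  "J4 = ({1..5}, {{x, y, 5} | x y. {x, y} \<subseteq> {1..4} \<and> x \<noteq> y})"

definition F32 :: "nat hgraph" where
  "F32 = ({1..5}, {{1, 2, 3}, {1, 2, 4}, {1, 2, 5}, {3, 4, 5}})"

lemma three_graph_J4: "three_graph J4"
proof -
  have "{x, y, 5} \<in> nsets {1..5} 3" if "{x, y} \<subseteq> {1..4}" "x \<noteq> y" for x y :: nat
  proof -
    have "x \<noteq> 5" "y \<noteq> 5"
      using that by auto
    then show ?thesis
      using that by (simp add: nsets_def)
  qed
  then show ?thesis
    unfolding three_graph_def J4_def by auto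
qed

lemma three_graph_F32: "three_graph F32"
  by (simp add: three_graph_def F32_def nsets_def)

lemma card_edges_le:
  assumes "three_graph G" "finite (verts G)"
  shows "finite (edges G)" "card (edges G) \<le> card (verts G) choose 3"
proof -
  have "finite (nsets (verts G) 3)"
    using assms(2) by (rule finite_imp_finite_nsets)
  then show "finite (edges G)" "card (edges G) \<le> card (verts G) choose 3"
    using assms card_mono[of "nsets (verts G) 3" "edges G"]
    by (auto simp: three_graph_def card_nsets intro: finite_subset)
qed

lemma finite_turan_ex_set:
  "finite {card (edges G) | G :: nat hgraph.
     three_graph G \<and> finite (verts G) \<and> card (verts G) = n \<and> free_of \<F> G}"
  by (rule finite_subset[of _ "{..n choose 3}"]) (auto dest: card_edges_le(2))

lemma turan_ex_ge:
  fixes G :: "nat hgraph"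
  assumes "three_graph G" "finite (verts G)" "card (verts G) = n" "free_of \<F> G"
  shows "card (edges G) \<le> turan_ex n \<F>"
  unfolding turan_ex_def using assms by (intro Max_ge finite_turan_ex_set) blast

lemma turan_ex_attained:
  fixes \<F> :: "'b hgraph set"
  assumes "\<And>H. H \<in> \<F> \<Longrightarrow> edges H \<noteq> {}"
  obtains G :: "nat hgraph" where "three_graph G" "finite (verts G)" "card (verts G) = n"
    "free_of \<F> G" "card (edges G) = turan_ex n \<F>"
proof -
  let ?S = "{card (edges G) | G :: nat hgraph.
     three_graph G \<and> finite (verts G) \<and> card (verts G) = n \<and> free_of \<F> G}"
  let ?G = "({..<n}, {}) :: nat hgraph"
  have "three_graph ?G \<and> finite (verts ?G) \<and> card (verts ?G) = n \<and> free_of \<F> ?G"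
    using assms by (auto simp: three_graph_def free_of_def contains_copy_def)
  then have "?S \<noteq> {}"
    by blast
  then have "turan_ex n \<F> \<in> ?S"
    unfolding turan_ex_def by (intro Max_in finite_turan_ex_set)
  then show thesis
    using that by auto
qed

lemma turan_ex_step:
  assumes "\<And>H. H \<in> \<F> \<Longrightarrow> edges H \<noteq> {}" and "n \<ge> 3"
  shows "turan_ex (Suc n) \<F> * (n - 2) \<le> Suc n * turan_ex n \<F>"
proof -
  obtain G :: "nat hgraph" where G: "three_graph G" "finite (verts G)" "card (verts G) = Suc n"
      "free_of \<F> G" "card (edges G) = turan_ex (Suc n) \<F>"
    using turan_ex_attained[OF assms(1)] by blast
  have fin: "finite (edges G)"
    using G card_edges_le by blast
  have le: "card {e \<in> edges G. v \<notin> e} \<le> turan_ex n \<F>" if "v \<in> verts G" for v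
  proof -
    let ?G = "(verts G - {v}, {e \<in> edges G. v \<notin> e})"
    have "three_graph ?G"
      using G(1) by (auto simp: three_graph_def nsets_def)
    moreover have "free_of \<F> ?G"
    proof -
      have "contains_copy G H" if "contains_copy ?G H" for H
        using that unfolding contains_copy_def by (auto simp: subset_iff)
      then show ?thesis
        using G(4) by (auto simp: free_of_def)
    qed
    ultimately show ?thesis
      using turan_ex_ge[of ?G n \<F>] G(2,3) that by simp
  qed
  have "turan_ex (Suc n) \<F> * (n - 2) = (\<Sum>e\<in>edges G. card {v \<in> verts G. v \<notin> e})"
  proof -
    have "card {v \<in> verts G. v \<notin> e} = n - 2" if "e \<in> edges G" for e
    proof -
      have "e \<subseteq> verts G" "finite e" "card e = 3"
        using that G(1) by (auto simp: three_graph_def nsets_def)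
      moreover have "{v \<in> verts G. v \<notin> e} = verts G - e"
        by auto
      ultimately show ?thesis
        using G(3) by (simp add: card_Diff_subset)
    qed
    then show ?thesis
      using G(5) by simp
  qed
  also have "\<dots> = (\<Sum>v\<in>verts G. card {e \<in> edges G. v \<notin> e})"
    by (rule sum_multicount_gen[symmetric]) (use G(2) fin in auto)
  also have "\<dots> \<le> (\<Sum>v\<in>verts G. turan_ex n \<F>)"
    by (intro sum_mono le)
  finally show ?thesis
    using G(3) by simp
qed

lemma convergent_turan_density:
  assumes "\<And>H. H \<in> \<F> \<Longrightarrow> edges H \<noteq> {}"
  shows "convergent (\<lambda>n. real (turan_ex n \<F>) / real (n choose 3))" (is "convergent ?a")
proof -
  have "?a (Suc m) \<le> ?a m" if "m \<ge> 3" for m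
  proof -
    have c: "(m choose 3) * Suc m = (Suc m choose 3) * (m - 2)"
      using binomial_absorb_comp[of "Suc m" 3] that by (simp add: mult.commute)
    have pos: "0 < m choose 3" "0 < Suc m choose 3" "0 < m - 2"
      using that by (auto simp: zero_less_binomial_iff)
    have "(turan_ex (Suc m) \<F> * (m choose 3)) * (m - 2)
        \<le> (Suc m * turan_ex m \<F>) * (m choose 3)"
    proof -
      have "turan_ex (Suc m) \<F> * (m - 2) \<le> Suc m * turan_ex m \<F>"
        using assms that by (rule turan_ex_step)
      then have "(turan_ex (Suc m) \<F> * (m - 2)) * (m choose 3)
          \<le> (Suc m * turan_ex m \<F>) * (m choose 3)"
        by (rule mult_le_mono1)
      then show ?thesis
        by (simp only: mult.assoc mult.commute mult.left_commute)
    qed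
    also have "\<dots> = (turan_ex m \<F> * (Suc m choose 3)) * (m - 2)"
      using c by (metis mult.assoc mult.commute)
    finally have "turan_ex (Suc m) \<F> * (m choose 3) \<le> turan_ex m \<F> * (Suc m choose 3)"
      using pos(3) by (simp only: mult_le_cancel2)
    then have "real (turan_ex (Suc m) \<F>) * real (m choose 3)
        \<le> real (turan_ex m \<F>) * real (Suc m choose 3)"
      by (metis of_nat_le_iff of_nat_mult)
    then show ?thesis
      using pos(1,2) by (simp add: frac_le_eq divide_le_0_iff del: binomial_Suc_Suc)
  qed
  then have step: "?a (Suc n + 3) \<le> ?a (n + 3)" for n
    by (metis add_Suc le_add2)
  have "decseq (\<lambda>n. ?a (n + 3))"
    by (intro decseq_SucI step)
  moreover have "0 \<le> ?a (n + 3)" for n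
    by simp
  ultimately obtain L where "(\<lambda>n. ?a (n + 3)) \<longlonglongrightarrow> L"
    using decseq_convergent by blast
  then have "convergent (\<lambda>n. ?a (n + 3))"
    by (rule convergentI)
  then show ?thesis
    by (rule iffD1[OF convergent_ignore_initial_segment])
qed

end

theory Submission
  imports Defs
begin

text \<open>
  Every pair of vertices of \<open>J4\<close> and of \<open>F32\<close> lies in an edge, so a copy of either of them is the
  same as a homomorphism, and degenerate tuples of vertices may be included in all counts: no error
  terms occur. With \<open>e a b c\<close> for the relation \<open>{a, b, c} \<in> E\<close>, the upper bound is the identity
  \<open>1620 n ^ 6 - 4320 n ^ 3 (\<Sum>a b c. e a b c) = (\<Sum>x \<in> V ^ 6. slack x) + squares\<close>, where two families of
  squares are used. The first one runs over the books \<open>a b c d\<close> (\<open>abc\<close> and \<open>abd\<close> are edges, \<open>acd\<close>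
  and \<open>bcd\<close> are not) and sums an integer vector depending on how \<open>x\<close> is attached to the book; the
  second one runs over pairs \<open>u v\<close> and sums an integer depending on how \<open>x y\<close> is attached to the pair.
  The pointwise inequality \<open>slack x \<ge> 0\<close> is a finite statement about 3-graphs on six vertices without
  \<open>J4\<close> and \<open>F32\<close>. Equality holds for the complete balanced 4-partite 3-graph.
\<close>

section \<open>Squares attached to six vertices\<close>

definition no_flag :: "int list" where "no_flag = replicate 11 0"

text \<open>
  The six arguments tell whether \<open>abx\<close>, \<open>acx\<close>, \<open>adx\<close>, \<open>bcx\<close>, \<open>bdx\<close>, \<open>cdx\<close> are edges. The integers were
  obtained by rounding the solution of a semidefinite program. Exchanging \<open>a\<close> and \<open>b\<close>, or \<open>c\<close> and
  \<open>d\<close>, changes the signs of some coordinates only. In the complete 4-partite 3-graph \<open>x\<close> can be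
  attached in four ways, whose vectors add up to \<open>0\<close>; \<open>no_flag\<close> stands for attachments that create
  a copy of \<open>F32\<close>.
\<close>

definition flag_vec :: "bool \<Rightarrow> bool \<Rightarrow> bool \<Rightarrow> bool \<Rightarrow>
    bool \<Rightarrow> bool \<Rightarrow> int list" where
  "flag_vec p q r s t u =
    (if p then (if u then no_flag
      else (if q then (if r then (if s then (if t then [- 24, - 1, 11, 0, 0, 0, 0, 0, 0, 0, 0]
          else [- 22, 2, 4, 0, - 1, - 7, - 8, 10, - 2, - 2, 5])
         else (if t then [- 22, 2, 4, 0, 1, 7, - 8, 10, 2, 2, - 5]
          else [- 20, 8, - 2, 0, 0, 0, - 6, 17, 0, 0, 0]))
        else (if s then (if t then [- 22, 2, 4, 0, - 1, - 7, 8, - 10, 2, 2, - 5]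
          else [- 9, 5, - 11, 5, - 10, - 9, 0, 0, 0, 0, 0])
         else (if t then [- 12, 1, - 1, 0, 0, 0, 0, 0, 1, 12, - 5]
          else [- 7, 0, - 12, 7, - 8, 1, 1, 7, 2, 9, 3])))
       else (if r then (if s then (if t then [- 22, 2, 4, 0, 1, 7, 8, - 10, - 2, - 2, 5]
          else [- 12, 1, - 1, 0, 0, 0, 0, 0, - 1, - 12, 5])
         else (if t then [- 9, 5, - 11, - 5, 10, 9, 0, 0, 0, 0, 0]
          else [- 7, 0, - 12, - 7, 8, - 1, 1, 7, - 2, - 9, - 3]))
        else (if s then (if t then [- 20, 8, - 2, 0, 0, 0, 6, - 17, 0, 0, 0]
          else [- 7, 0, - 12, 7, - 8, 1, - 1, - 7, - 2, - 9, - 3])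
         else (if t then [- 7, 0, - 12, - 7, 8, - 1, - 1, - 7, 2, 9, 3]
          else [- 4, - 7, - 11, 0, 0, 0, 0, 0, 0, 0, 0])))))
     else (if u then (if q then (if r then (if s then no_flag
         else (if t then no_flag
          else [12, 12, 6, 0, 0, 0, 6, 11, 0, 0, 0]))
        else (if s then no_flag
         else (if t then [2, 2, 14, 0, 0, 0, 0, 0, - 13, - 8, - 5]
          else [7, - 1, - 2, 1, - 8, 7, 8, 10, - 1, - 6, 4])))
       else (if r then (if s then (if t then no_flag
          else [2, 2, 14, 0, 0, 0, 0, 0, 13, 8, 5])
         else (if t then no_flag
          else [7, - 1, - 2, - 1, 8, - 7, 8, 10, 1, 6, - 4]))
        else (if s then (if t then [12, 12, 6, 0, 0, 0, - 6, - 11, 0, 0, 0]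
          else [7, - 1, - 2, 1, - 8, 7, - 8, - 10, 1, 6, - 4])
         else (if t then [7, - 1, - 2, - 1, 8, - 7, - 8, - 10, - 1, - 6, 4]
          else [4, - 9, - 2, 0, 0, 0, 0, 0, 0, 0, 0]))))
      else (if q then (if r then (if s then (if t then [- 21, 11, 1, 0, 0, 0, 0, 0, 0, 0, 0]
          else [- 5, - 5, 6, 16, 11, 0, 2, 8, 15, - 8, - 6])
         else (if t then [- 5, - 5, 6, - 16, - 11, 0, 2, 8, - 15, 8, 6]
          else [14, 4, 0, 0, 0, 0, 17, 3, 0, 0, 0]))
        else (if s then (if t then [- 5, - 5, 6, 16, 11, 0, - 2, - 8, - 15, 8, 6]
          else [5, 9, - 5, 15, - 1, 0, 0, 0, 0, 0, 0])
         else (if t then [3, 2, 12, 0, 0, 0, 0, 0, - 14, - 1, 1]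
          else [12, 1, - 1, 6, - 8, 5, 14, 4, - 2, 2, 7])))
       else (if r then (if s then (if t then [- 5, - 5, 6, - 16, - 11, 0, - 2, - 8, 15, - 8, - 6]
          else [3, 2, 12, 0, 0, 0, 0, 0, 14, 1, - 1])
         else (if t then [5, 9, - 5, - 15, 1, 0, 0, 0, 0, 0, 0]
          else [12, 1, - 1, - 6, 8, - 5, 14, 4, 2, - 2, - 7]))
        else (if s then (if t then [14, 4, 0, 0, 0, 0, - 17, - 3, 0, 0, 0]
          else [12, 1, - 1, 6, - 8, 5, - 14, - 4, 2, - 2, - 7])
         else (if t then [12, 1, - 1, - 6, 8, - 5, - 14, - 4, - 2, 2, 7]
          else [12, - 6, 5, 0, 0, 0, 0, 0, 0, 0, 0]))))))"

fun dot :: "int list \<Rightarrow> int list \<Rightarrow> int" where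
  "dot (x # xs) (y # ys) = x * y + dot xs ys"
| "dot _ _ = 0"

definition book_product ::
  "bool \<Rightarrow> bool \<Rightarrow> bool \<Rightarrow> bool \<Rightarrow>
    bool \<Rightarrow> bool \<Rightarrow> bool \<Rightarrow> bool \<Rightarrow>
    bool \<Rightarrow> bool \<Rightarrow> bool \<Rightarrow> bool \<Rightarrow>
    bool \<Rightarrow> bool \<Rightarrow> bool \<Rightarrow> bool \<Rightarrow> int" where
  "book_product p q r s x1 x2 x3 x4 x5 x6 y1 y2 y3 y4 y5 y6 =
     (if p then if q then if r then 0 else if s then 0
      else dot (flag_vec x1 x2 x3 x4 x5 x6) (flag_vec y1 y2 y3 y4 y5 y6) else 0 else 0)"

text \<open>
  The arguments tell whether \<open>uvx\<close>, \<open>uvy\<close>, \<open>uxy\<close>, \<open>vxy\<close> are edges. In the complete balanced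
  4-partite 3-graph the weight has mean \<open>0\<close> over all \<open>x\<close>, \<open>y\<close>, for \<open>u\<close> and \<open>v\<close> in the same part
  (densities \<open>5/8\<close> of \<open>6\<close> and \<open>3/8\<close> of \<open>- 10\<close>) as well as in different parts (densities \<open>1/4\<close> of
  \<open>6\<close> and \<open>1/2\<close> of \<open>- 3\<close>).
\<close>

definition pair_weight :: "bool \<Rightarrow> bool \<Rightarrow> bool \<Rightarrow> bool \<Rightarrow> int" where
  "pair_weight p q r s =
    (if p \<noteq> q then if r \<noteq> s then - 3 else 0
     else if p then 0 else if r \<noteq> s then 0 else if r then - 10 else 6)"

text \<open>
  Products of two vectors or weights are attached to ordered partitions \<open>ab | cd | xy\<close> of six
  vertices, so it is enough to symmetrise over the 15 perfect matchings of the six vertices.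
\<close>

definition matching_sum ::
  "bool \<Rightarrow> bool \<Rightarrow> bool \<Rightarrow> bool \<Rightarrow>
    bool \<Rightarrow> bool \<Rightarrow> bool \<Rightarrow> bool \<Rightarrow>
    bool \<Rightarrow> bool \<Rightarrow> bool \<Rightarrow> bool \<Rightarrow>
    bool \<Rightarrow> bool \<Rightarrow> bool \<Rightarrow> bool \<Rightarrow>
    bool \<Rightarrow> bool \<Rightarrow> bool \<Rightarrow> bool \<Rightarrow> int" where
  "matching_sum
     abc abd acd bcd abx acx bcx adx bdx cdx aby acy bcy ady bdy cdy axy bxy cxy dxy =
     book_product abc abd acd bcd  abx acx adx bcx bdx cdx  aby acy ady bcy bdy cdy
     + book_product abx aby axy bxy  abc acx acy bcx bcy cxy  abd adx ady bdx bdy dxy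
     + book_product acd bcd abc abd  cdx acx bcx adx bdx abx  cdy acy bcy ady bdy aby
     + book_product cdx cdy cxy dxy  acd acx acy adx ady axy  bcd bcx bcy bdx bdy bxy
     + book_product axy bxy abx aby  cxy acx bcx acy bcy abc  dxy adx bdx ady bdy abd
     + book_product cxy dxy cdx cdy  axy acx adx acy ady acd  bxy bcx bdx bcy bdy bcd
     + pair_weight abc abd acd bcd * pair_weight abx aby axy bxy
     + pair_weight acd bcd abc abd * pair_weight cdx cdy cxy dxy
     + pair_weight axy bxy abx aby * pair_weight cxy dxy cdx cdy"

text \<open>
  A 3-graph on the vertices \<open>0, \<dots>, 5\<close> is encoded by 20 booleans; the triple \<open>i < j < k\<close> has the index
  \<open>i + (j choose 2) + (k choose 3)\<close>, so that the first 10 booleans describe the vertices \<open>0, \<dots>, 4\<close>.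
\<close>

definition slack ::
  "bool \<Rightarrow> bool \<Rightarrow> bool \<Rightarrow> bool \<Rightarrow>
    bool \<Rightarrow> bool \<Rightarrow> bool \<Rightarrow> bool \<Rightarrow>
    bool \<Rightarrow> bool \<Rightarrow> bool \<Rightarrow> bool \<Rightarrow>
    bool \<Rightarrow> bool \<Rightarrow> bool \<Rightarrow> bool \<Rightarrow>
    bool \<Rightarrow> bool \<Rightarrow> bool \<Rightarrow> bool \<Rightarrow> int" where
  "slack
     e0 e1 e2 e3 e4 e5 e6 e7 e8 e9 e10 e11 e12 e13 e14 e15 e16 e17 e18 e19 =
     1620 - 216 *
      (of_bool e0 + of_bool e1 + of_bool e2 + of_bool e3 + of_bool e4 + of_bool e5 +
       of_bool e6 + of_bool e7 + of_bool e8 + of_bool e9 + of_bool e10 + of_bool e11 +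
       of_bool e12 + of_bool e13 + of_bool e14 + of_bool e15 + of_bool e16 + of_bool e17 +
       of_bool e18 + of_bool e19)
     - (matching_sum e0 e1 e2 e3 e4 e5 e6 e7 e8 e9 e10 e11 e12 e13 e14 e15 e16 e17 e18 e19
      + matching_sum e0 e4 e5 e6 e1 e2 e3 e7 e8 e9 e10 e11 e12 e16 e17 e18 e13 e14 e15 e19
      + matching_sum e0 e10 e11 e12 e1 e2 e3 e13 e14 e15 e4 e5 e6 e16 e17 e18 e7 e8 e9 e19
      + matching_sum e0 e2 e1 e3 e5 e4 e6 e7 e9 e8 e11 e10 e12 e13 e15 e14 e16 e18 e17 e19
      + matching_sum e0 e5 e4 e6 e2 e1 e3 e7 e9 e8 e11 e10 e12 e16 e18 e17 e13 e15 e14 e19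
      + matching_sum e0 e11 e10 e12 e2 e1 e3 e13 e15 e14 e5 e4 e6 e16 e18 e17 e7 e9 e8 e19
      + matching_sum e1 e2 e0 e3 e7 e4 e8 e5 e9 e6 e13 e10 e14 e11 e15 e12 e16 e19 e17 e18
      + matching_sum e1 e7 e4 e8 e2 e0 e3 e5 e9 e6 e13 e10 e14 e16 e19 e17 e11 e15 e12 e18
      + matching_sum e1 e13 e10 e14 e2 e0 e3 e11 e15 e12 e7 e4 e8 e16 e19 e17 e5 e9 e6 e18
      + matching_sum e4 e5 e0 e6 e7 e1 e8 e2 e9 e3 e16 e10 e17 e11 e18 e12 e13 e19 e14 e15
      + matching_sum e4 e7 e1 e8 e5 e0 e6 e2 e9 e3 e16 e10 e17 e13 e19 e14 e11 e18 e12 e15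
      + matching_sum e4 e16 e10 e17 e5 e0 e6 e11 e18 e12 e7 e1 e8 e13 e19 e14 e2 e9 e3 e15
      + matching_sum e10 e11 e0 e12 e13 e1 e14 e2 e15 e3 e16 e4 e17 e5 e18 e6 e7 e19 e8 e9
      + matching_sum e10 e13 e1 e14 e11 e0 e12 e2 e15 e3 e16 e4 e17 e7 e19 e8 e5 e18 e6 e9
      + matching_sum e10 e16 e4 e17 e11 e0 e12 e5 e18 e6 e13 e1 e14 e7 e19 e8 e2 e15 e3 e9)"

text \<open>The first ten clauses exclude \<open>F32\<close>, one for each choice of the pair lying
  in three of its edges; the last five exclude \<open>J4\<close>, one for each apex.\<close>

definition admissible :: "bool \<Rightarrow> bool \<Rightarrow> bool \<Rightarrow> bool \<Rightarrow>
    bool \<Rightarrow> bool \<Rightarrow> bool \<Rightarrow> bool \<Rightarrow>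
    bool \<Rightarrow> bool \<Rightarrow> bool" where
  "admissible e0 e1 e2 e3 e4 e5 e6 e7 e8 e9 \<longleftrightarrow>
    \<not> (e0 \<and> e1 \<and> e4 \<and> e9) \<and>
    \<not> (e0 \<and> e2 \<and> e5 \<and> e8) \<and>
    \<not> (e0 \<and> e3 \<and> e6 \<and> e7) \<and>
    \<not> (e0 \<and> e7 \<and> e8 \<and> e9) \<and>
    \<not> (e1 \<and> e2 \<and> e6 \<and> e7) \<and>
    \<not> (e1 \<and> e3 \<and> e5 \<and> e8) \<and>
    \<not> (e1 \<and> e5 \<and> e6 \<and> e9) \<and>
    \<not> (e2 \<and> e3 \<and> e4 \<and> e9) \<and>
    \<not> (e2 \<and> e4 \<and> e6 \<and> e8) \<and>
    \<not> (e3 \<and> e4 \<and> e5 \<and> e7) \<and>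
    \<not> (e0 \<and> e1 \<and> e2 \<and> e4 \<and> e5 \<and> e7) \<and>
    \<not> (e0 \<and> e1 \<and> e3 \<and> e4 \<and> e6 \<and> e8) \<and>
    \<not> (e0 \<and> e2 \<and> e3 \<and> e5 \<and> e6 \<and> e9) \<and>
    \<not> (e1 \<and> e2 \<and> e3 \<and> e7 \<and> e8 \<and> e9) \<and>
    \<not> (e4 \<and> e5 \<and> e6 \<and> e7 \<and> e8 \<and> e9)"

section \<open>Six-vertex graphs\<close>

fun lex_ge :: "bool list \<Rightarrow> bool list \<Rightarrow> bool" where
  "lex_ge (x # xs) (y # ys) =
     (if x then if y then lex_ge xs ys else True else if y then False else lex_ge xs ys)"
| "lex_ge _ _ = True"

fun all_ext :: "nat \<Rightarrow> (bool list \<Rightarrow> bool) \<Rightarrow> bool list \<Rightarrow> bool" where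
  "all_ext 0 P bs = P bs"
| "all_ext (Suc n) P bs = (if all_ext n P (bs @ [True]) then all_ext n P (bs @ [False]) else False)"

text \<open>
  The search is restricted to codes that do not increase lexicographically when two consecutive
  vertices are swapped, which leaves 1684 of the labelled 3-graphs.
\<close>

fun check20 :: "bool list \<Rightarrow> bool" where
  "check20 [e0, e1, e2, e3, e4, e5, e6, e7, e8, e9, e10, e11, e12, e13, e14, e15, e16, e17,
             e18, e19] = (
   if \<not> admissible e0 e4 e5 e6 e10 e11 e12 e16 e17 e18 then True else
   if \<not> admissible e1 e4 e7 e8 e10 e13 e14 e16 e17 e19 then True else
   if \<not> admissible e2 e5 e7 e9 e11 e13 e15 e16 e18 e19 then True else
   if \<not> admissible e3 e6 e8 e9 e12 e14 e15 e17 e18 e19 then True else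
   if \<not> lex_ge [e0, e1, e2, e3, e4, e5, e6, e7, e8, e9, e10, e11, e12, e13, e14, e15, e16, e17,
             e18, e19]
      [e0, e1, e3, e2, e4, e6, e5, e8, e7, e9, e10, e12, e11, e14, e13, e15, e17, e16,
             e18, e19] then True else
   if \<not> lex_ge [e0, e1, e2, e3, e4, e5, e6, e7, e8, e9, e10, e11, e12, e13, e14, e15, e16, e17,
             e18, e19]
      [e0, e2, e1, e3, e5, e4, e6, e7, e9, e8, e11, e10, e12, e13, e15, e14, e16, e18,
             e17, e19] then True else
   if \<not> lex_ge [e0, e1, e2, e3, e4, e5, e6, e7, e8, e9, e10, e11, e12, e13, e14, e15, e16, e17,
             e18, e19]
      [e1, e0, e2, e3, e4, e7, e8, e5, e6, e9, e10, e13, e14, e11, e12, e15, e16, e17,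
             e19, e18] then True else
   if \<not> lex_ge [e0, e1, e2, e3, e4, e5, e6, e7, e8, e9, e10, e11, e12, e13, e14, e15, e16, e17,
             e18, e19]
      [e0, e4, e5, e6, e1, e2, e3, e7, e8, e9, e10, e11, e12, e16, e17, e18, e13, e14,
             e15, e19] then True else
   if \<not> lex_ge [e0, e1, e2, e3, e4, e5, e6, e7, e8, e9, e10, e11, e12, e13, e14, e15, e16, e17,
             e18, e19]
      [e0, e1, e2, e3, e10, e11, e12, e13, e14, e15, e4, e5, e6, e7, e8, e9, e16, e17,
             e18, e19] then True else
   0 \<le> slack e0 e1 e2 e3 e4 e5 e6 e7 e8 e9 e10 e11 e12 e13 e14 e15 e16 e17 e18 e19)"
| "check20 _ = True"

text \<open>Sixteen booleans already determine the triples inside \<open>{0, 1, 2, 3, 5}\<close>, so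
  this five-set is tested before branching over the four triples that contain both 4 and 5.\<close>

fun check16 :: "bool list \<Rightarrow> bool" where
  "check16 [e0, e1, e2, e3, e4, e5, e6, e7, e8, e9, e10, e11, e12, e13, e14, e15] = (
   if \<not> admissible e0 e1 e2 e3 e10 e11 e12 e13 e14 e15 then True else
   all_ext 4 check20 [e0, e1, e2, e3, e4, e5, e6, e7, e8, e9, e10, e11, e12, e13, e14, e15])"
| "check16 _ = True"

fun check10 :: "bool list \<Rightarrow> bool" where
  "check10 [e0, e1, e2, e3, e4, e5, e6, e7, e8, e9] = (
   if \<not> admissible e0 e1 e2 e3 e4 e5 e6 e7 e8 e9 then True else
   if \<not> lex_ge [e0, e1, e2, e3, e4, e5, e6, e7, e8, e9]
      [e0, e1, e3, e2, e4, e6, e5, e8, e7, e9] then True else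
   if \<not> lex_ge [e0, e1, e2, e3, e4, e5, e6, e7, e8, e9]
      [e0, e2, e1, e3, e5, e4, e6, e7, e9, e8] then True else
   if \<not> lex_ge [e0, e1, e2, e3, e4, e5, e6, e7, e8, e9]
      [e1, e0, e2, e3, e4, e7, e8, e5, e6, e9] then True else
   if \<not> lex_ge [e0, e1, e2, e3, e4, e5, e6, e7, e8, e9]
      [e0, e4, e5, e6, e1, e2, e3, e7, e8, e9] then True else
   all_ext 6 check16 [e0, e1, e2, e3, e4, e5, e6, e7, e8, e9])"
| "check10 _ = True"

text \<open>The finite core of the upper bound, evaluated by rewriting with the code
  equations.\<close>

lemma check: "all_ext 10 check10 []"
  by code_simp

lemma all_extD: "all_ext n P bs \<Longrightarrow> length cs = n \<Longrightarrow> P (bs @ cs)"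
proof (induction n arbitrary: bs cs)
  case (Suc n)
  then obtain c cs' where "cs = c # cs'" "length cs' = n"
    by (cases cs) auto
  then show ?case
    using Suc.IH[of "bs @ [c]" cs'] Suc.prems(1) by (cases c) (auto split: if_splits)
qed simp

lemma lex_ge_append: "lex_ge (xs @ xs') (ys @ ys') \<Longrightarrow> length xs = length ys \<Longrightarrow> lex_ge xs ys"
  by (induction xs ys rule: lex_ge.induct) (auto split: if_splits)

text \<open>A binary numeral with the head as most significant bit: lexicographic maximality becomes
  maximality of a natural number.\<close>

fun code :: "bool list \<Rightarrow> nat" where
  "code [] = 0"
| "code (b # bs) = of_bool b * 2 ^ length bs + code bs"

lemma code_less: "code bs < 2 ^ length bs"
  by (induction bs) auto

lemma lex_ge_code: "length xs = length ys \<Longrightarrow> code ys \<le> code xs \<Longrightarrow> lex_ge xs ys"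
proof (induction xs ys rule: lex_ge.induct)
  case (1 x xs y ys)
  then show ?case
    using code_less[of xs] by (cases x; cases y) auto
qed auto

lemma slack_nonneg:
  assumes adm: "admissible e0 e1 e2 e3 e4 e5 e6 e7 e8 e9"
      "admissible e0 e1 e2 e3 e10 e11 e12 e13 e14 e15"
      "admissible e0 e4 e5 e6 e10 e11 e12 e16 e17 e18"
      "admissible e1 e4 e7 e8 e10 e13 e14 e16 e17 e19"
      "admissible e2 e5 e7 e9 e11 e13 e15 e16 e18 e19"
      "admissible e3 e6 e8 e9 e12 e14 e15 e17 e18 e19"
    and lex:
      "lex_ge [e0, e1, e2, e3, e4, e5, e6, e7, e8, e9, e10, e11, e12, e13, e14, e15, e16, e17, e18,
           e19]
      [e0, e1, e3, e2, e4, e6, e5, e8, e7, e9, e10, e12, e11, e14, e13, e15, e17, e16, e18,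
           e19]"
      "lex_ge [e0, e1, e2, e3, e4, e5, e6, e7, e8, e9, e10, e11, e12, e13, e14, e15, e16, e17, e18,
           e19]
      [e0, e2, e1, e3, e5, e4, e6, e7, e9, e8, e11, e10, e12, e13, e15, e14, e16, e18, e17,
           e19]"
      "lex_ge [e0, e1, e2, e3, e4, e5, e6, e7, e8, e9, e10, e11, e12, e13, e14, e15, e16, e17, e18,
           e19]
      [e1, e0, e2, e3, e4, e7, e8, e5, e6, e9, e10, e13, e14, e11, e12, e15, e16, e17, e19,
           e18]"
      "lex_ge [e0, e1, e2, e3, e4, e5, e6, e7, e8, e9, e10, e11, e12, e13, e14, e15, e16, e17, e18,
           e19]
      [e0, e4, e5, e6, e1, e2, e3, e7, e8, e9, e10, e11, e12, e16, e17, e18, e13, e14, e15,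
           e19]"
      "lex_ge [e0, e1, e2, e3, e4, e5, e6, e7, e8, e9, e10, e11, e12, e13, e14, e15, e16, e17, e18,
           e19]
      [e0, e1, e2, e3, e10, e11, e12, e13, e14, e15, e4, e5, e6, e7, e8, e9, e16, e17, e18,
           e19]"
  shows "0 \<le> slack
    e0 e1 e2 e3 e4 e5 e6 e7 e8 e9 e10 e11 e12 e13 e14 e15 e16 e17 e18 e19"
proof -
  \<comment> \<open>These four swaps fix the vertex 5, hence permute the first ten booleans among
    themselves, and lexicographic comparison passes to prefixes.\<close>
  have prefix:
    "lex_ge [e0, e1, e2, e3, e4, e5, e6, e7, e8, e9] [e0, e1, e3, e2, e4, e6, e5, e8, e7, e9]"
    "lex_ge [e0, e1, e2, e3, e4, e5, e6, e7, e8, e9] [e0, e2, e1, e3, e5, e4, e6, e7, e9, e8]"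
    "lex_ge [e0, e1, e2, e3, e4, e5, e6, e7, e8, e9] [e1, e0, e2, e3, e4, e7, e8, e5, e6, e9]"
    "lex_ge [e0, e1, e2, e3, e4, e5, e6, e7, e8, e9] [e0, e4, e5, e6, e1, e2, e3, e7, e8, e9]"
    by (rule lex_ge_append; use lex in force)+
  have "check10 ([] @ [e0, e1, e2, e3, e4, e5, e6, e7, e8, e9])"
    using check by (rule all_extD) simp
  then have "all_ext 6 check16 [e0, e1, e2, e3, e4, e5, e6, e7, e8, e9]"
    using adm(1) prefix by simp
  then have "check16 ([e0, e1, e2, e3, e4, e5, e6, e7, e8, e9] @ [e10, e11, e12, e13, e14, e15])"
    by (rule all_extD) simp
  then have "all_ext 4 check20 [e0, e1, e2, e3, e4, e5, e6, e7, e8, e9, e10, e11, e12, e13, e14, e15]"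
    using adm(2) by simp
  then have "check20 ([e0, e1, e2, e3, e4, e5, e6, e7, e8, e9, e10, e11, e12, e13, e14, e15] @ [e16, e17, e18, e19])"
    by (rule all_extD) simp
  then show ?thesis
    using adm(3-6) lex by simp
qed

section \<open>Counting over all sextuples\<close>

lemma length_flag_vec: "length (flag_vec p q r s t u) = 11"
  by (simp add: flag_vec_def no_flag_def)

lemma dot_commute: "dot v w = dot w v"
  by (induction v w rule: dot.induct) simp_all

lemma dot_eq_sum: "length v = n \<Longrightarrow> length w = n \<Longrightarrow> dot v w = (\<Sum>k<n. v ! k * w ! k)"
proof (induction v arbitrary: w n)
  case (Cons x v)
  then obtain y w' m where "w = y # w'" "n = Suc m" "length w' = m" "length v = m"
    by (cases w) auto
  then show ?case
    using Cons.IH[of m w'] by (simp only: sum.lessThan_Suc_shift) simp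
qed simp

text \<open>Signs square to 1. This makes book products invariant although the flag vectors
  themselves change under the symmetries of a book.\<close>

lemma dot_signs:
  assumes "\<forall>s\<in>set ss. s * s = 1" "length v \<le> length ss"
  shows "dot (map2 (*) ss v) (map2 (*) ss w) = dot v w"
  using assms
proof (induction ss arbitrary: v w)
  case (Cons s ss)
  show ?case
  proof (cases "v = [] \<or> w = []")
    case False
    then obtain x v' y w' where "v = x # v'" "w = y # w'"
      by (meson list.exhaust)
    moreover have "s * x * (s * y) = x * y"
      using Cons.prems(1) by (simp add: algebra_simps)
    ultimately show ?thesis
      using Cons by simp
  qed (auto elim: dot.elims)
qed simp

text \<open>In a book \<open>a b c d\<close> the spine is \<open>ab\<close> and the pages are
  \<open>c\<close>, \<open>d\<close>. The coordinates are grouped by their behaviour under the two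
  swaps: three are even under both, three odd only for the pages, two odd only for the spine, three
  odd for both.\<close>

lemma flag_vec_swap_spine:
  "flag_vec p s t q r u = map2 (*) [1, 1, 1, 1, 1, 1, - 1, - 1, - 1, - 1, - 1] (flag_vec p q r s t u)"
  by (simp add: flag_vec_def no_flag_def numeral_eq_Suc)

lemma flag_vec_swap_pages:
  "flag_vec p r q t s u = map2 (*) [1, 1, 1, - 1, - 1, - 1, 1, 1, - 1, - 1, - 1] (flag_vec p q r s t u)"
  by (simp add: flag_vec_def no_flag_def numeral_eq_Suc)

lemma book_product_swap_spine:
  "book_product p q s r x1 x4 x5 x2 x3 x6 y1 y4 y5 y2 y3 y6 =
   book_product p q r s x1 x2 x3 x4 x5 x6 y1 y2 y3 y4 y5 y6"
  unfolding book_product_def flag_vec_swap_spine[of x1 x4 x5] flag_vec_swap_spine[of y1 y4 y5]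
  by (subst dot_signs) (simp_all add: length_flag_vec)

lemma book_product_swap_pages:
  "book_product q p r s x1 x3 x2 x5 x4 x6 y1 y3 y2 y5 y4 y6 =
   book_product p q r s x1 x2 x3 x4 x5 x6 y1 y2 y3 y4 y5 y6"
  unfolding book_product_def flag_vec_swap_pages[of x1 x3 x2] flag_vec_swap_pages[of y1 y3 y2]
  by (subst dot_signs) (simp_all add: length_flag_vec)

lemma book_product_swap_tips:
  "book_product p q r s y1 y2 y3 y4 y5 y6 x1 x2 x3 x4 x5 x6 =
   book_product p q r s x1 x2 x3 x4 x5 x6 y1 y2 y3 y4 y5 y6"
  unfolding book_product_def by (simp add: dot_commute)

lemma pair_weight_swap: "pair_weight q p r s = pair_weight p q r s"
  "pair_weight p q s r = pair_weight p q r s"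
  by (auto simp: pair_weight_def)

section \<open>Symmetrised slack and sums of squares for a symmetric ternary relation\<close>

locale symmetric_triples =
  fixes e :: "'a \<Rightarrow> 'a \<Rightarrow> 'a \<Rightarrow> bool"
  assumes swap12: "e a b c = e b a c" and swap23: "e a b c = e a c b"
begin

lemma swap13: "e a b c = e c b a"
  using swap12 swap23 by metis

text \<open>Permutative rules: ordered rewriting with them sorts the arguments of \<open>e\<close>,
  which identifies relabelled terms.\<close>

lemmas sym = swap12 swap23 swap13

definition book :: "'a \<Rightarrow> 'a \<Rightarrow> 'a \<Rightarrow> 'a \<Rightarrow> 'a \<Rightarrow> 'a \<Rightarrow> int" where
  "book a b c d x y = book_product (e a b c) (e a b d) (e a c d) (e b c d)
     (e a b x) (e a c x) (e a d x) (e b c x) (e b d x) (e c d x)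
     (e a b y) (e a c y) (e a d y) (e b c y) (e b d y) (e c d y)"

definition weight :: "'a \<Rightarrow> 'a \<Rightarrow> 'a \<Rightarrow> 'a \<Rightarrow> int" where
  "weight u v x y = pair_weight (e u v x) (e u v y) (e u x y) (e v x y)"

definition matching :: "'a \<Rightarrow> 'a \<Rightarrow> 'a \<Rightarrow> 'a \<Rightarrow> 'a \<Rightarrow> 'a \<Rightarrow> int" where
  "matching a b c d x y = matching_sum
     (e a b c) (e a b d) (e a c d) (e b c d) (e a b x) (e a c x) (e b c x) (e a d x) (e b d x)
     (e c d x) (e a b y) (e a c y) (e b c y) (e a d y) (e b d y) (e c d y) (e a x y) (e b x y)
     (e c x y) (e d x y)"

definition tuple_slack :: "'a \<Rightarrow> 'a \<Rightarrow> 'a \<Rightarrow> 'a \<Rightarrow> 'a \<Rightarrow> 'a \<Rightarrow> int" where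
  "tuple_slack a b c d x y = slack
     (e a b c) (e a b d) (e a c d) (e b c d) (e a b x) (e a c x) (e b c x) (e a d x) (e b d x)
     (e c d x) (e a b y) (e a c y) (e b c y) (e a d y) (e b d y) (e c d y) (e a x y) (e b x y)
     (e c x y) (e d x y)"

lemma book_swap: "book b a c d x y = book a b c d x y" "book a b d c x y = book a b c d x y"
  "book a b c d y x = book a b c d x y"
  unfolding book_def
    apply (subst book_product_swap_spine[symmetric], simp only: sym)
   apply (subst book_product_swap_pages[symmetric], simp only: sym)
  apply (rule book_product_swap_tips)
  done

lemma weight_swap: "weight v u x y = weight u v x y" "weight u v y x = weight u v x y"
  unfolding weight_def by (subst pair_weight_swap, simp only: sym)+

text \<open>The three pairs \<open>ab\<close>, \<open>cd\<close>, \<open>xy\<close> can serve as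
  spine, pages and tips in six ways; a product of weights only singles out the common pair, which
  gives three terms.\<close>

lemma matching_eq: "matching a b c d x y =
    book a b c d x y + book a b x y c d + book c d a b x y +
    book c d x y a b + book x y a b c d + book x y c d a b +
    weight a b c d * weight a b x y + weight c d a b * weight c d x y +
    weight x y a b * weight x y c d"
  by (simp only: matching_def matching_sum_def book_def weight_def sym)

lemma matching_swap: "matching b a c d x y = matching a b c d x y"
  "matching a b d c x y = matching a b c d x y" "matching a b c d y x = matching a b c d x y"
  "matching c d a b x y = matching a b c d x y" "matching a b x y c d = matching a b c d x y"
  by (simp_all only: matching_eq book_swap weight_swap) simp_all

lemma tuple_slack_eq: "tuple_slack a b c d x y = 1620 - 216 *
     (of_bool (e a b c) + of_bool (e a b d) + of_bool (e a c d) + of_bool (e b c d) +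
      of_bool (e a b x) + of_bool (e a c x) + of_bool (e b c x) + of_bool (e a d x) +
      of_bool (e b d x) + of_bool (e c d x) + of_bool (e a b y) + of_bool (e a c y) +
      of_bool (e b c y) + of_bool (e a d y) + of_bool (e b d y) + of_bool (e c d y) +
      of_bool (e a x y) + of_bool (e b x y) + of_bool (e c x y) + of_bool (e d x y))
     - (matching a b c d x y + matching a b c x d y + matching a b c y d x +
       matching a c b d x y + matching a c b x d y + matching a c b y d x +
       matching a d b c x y + matching a d b x c y + matching a d b y c x +
       matching a x b c d y + matching a x b d c y + matching a x b y c d +
       matching a y b c d x + matching a y b d c x + matching a y b x c d)"
  by (simp only: tuple_slack_def slack_def matching_def sym)

text \<open>A swap of neighbours permutes the twenty triples and the fifteen matchings among
  themselves.\<close>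

lemma tuple_slack_swap:
  "tuple_slack b a c d x y = tuple_slack a b c d x y"
  "tuple_slack a c b d x y = tuple_slack a b c d x y"
  "tuple_slack a b d c x y = tuple_slack a b c d x y"
  "tuple_slack a b c x d y = tuple_slack a b c d x y"
  "tuple_slack a b c d y x = tuple_slack a b c d x y"
  unfolding tuple_slack_eq by (simp_all only: sym matching_swap) simp_all

text \<open>The double sum is the squared Euclidean norm of the sum of all flag vectors.\<close>

lemma sum_square_flag_vec:
  "(\<Sum>x\<in>V. \<Sum>y\<in>V. dot (flag_vec (e a b x) (e a c x) (e a d x) (e b c x) (e b d x) (e c d x))
                (flag_vec (e a b y) (e a c y) (e a d y) (e b c y) (e b d y) (e c d y))) \<ge> 0"
proof -
  define f where "f x = flag_vec (e a b x) (e a c x) (e a d x) (e b c x) (e b d x) (e c d x)" for x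
  have "(\<Sum>x\<in>V. \<Sum>y\<in>V. dot (f x) (f y)) = (\<Sum>x\<in>V. \<Sum>y\<in>V. \<Sum>k<11. f x ! k * f y ! k)"
    by (intro sum.cong refl dot_eq_sum) (simp_all add: f_def length_flag_vec)
  also have "\<dots> = (\<Sum>k<11. \<Sum>x\<in>V. \<Sum>y\<in>V. f x ! k * f y ! k)"
    by (subst (2) sum.swap, subst sum.swap) (rule refl)
  also have "\<dots> = (\<Sum>k<11. (\<Sum>x\<in>V. f x ! k)\<^sup>2)"
    by (simp add: power2_eq_square sum_product)
  also have "\<dots> \<ge> 0"
    by (intro sum_nonneg) simp
  finally show ?thesis
    by (simp add: f_def)
qed

lemma sum_book_nonneg:
  "(\<Sum>a\<in>V. \<Sum>b\<in>V. \<Sum>c\<in>V. \<Sum>d\<in>V. \<Sum>x\<in>V. \<Sum>y\<in>V. book a b c d x y) \<ge> 0"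
proof (rule sum_nonneg, rule sum_nonneg, rule sum_nonneg, rule sum_nonneg)
  fix a b c d
  show "(\<Sum>x\<in>V. \<Sum>y\<in>V. book a b c d x y) \<ge> 0"
  proof (cases "e a b c \<and> e a b d \<and> \<not> e a c d \<and> \<not> e b c d")
    case True
    then show ?thesis
      using sum_square_flag_vec[of a b c d V] by (simp add: book_def book_product_def)
  next
    case False
    then have "book a b c d x y = 0" for x y
      by (auto simp: book_def book_product_def)
    then show ?thesis
      by simp
  qed
qed

lemma sum_weight_nonneg:
  "(\<Sum>u\<in>V. \<Sum>v\<in>V. \<Sum>w\<in>V. \<Sum>x\<in>V. \<Sum>y\<in>V. \<Sum>z\<in>V. weight u v w x * weight u v y z) \<ge> 0"
proof (rule sum_nonneg, rule sum_nonneg)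
  fix u v
  have "(\<Sum>w\<in>V. \<Sum>x\<in>V. \<Sum>y\<in>V. \<Sum>z\<in>V. weight u v w x * weight u v y z)
      = (\<Sum>w\<in>V. \<Sum>x\<in>V. weight u v w x)\<^sup>2"
    by (simp only: power2_eq_square sum_distrib_right) (simp only: sum_distrib_left)
  then show "(\<Sum>w\<in>V. \<Sum>x\<in>V. \<Sum>y\<in>V. \<Sum>z\<in>V. weight u v w x * weight u v y z) \<ge> 0"
    by simp
qed

end

section \<open>Six-fold sums and their invariance under renaming the variables\<close>

lemma sum_PiE_lessThan_Suc:
  fixes F :: "(nat \<Rightarrow> 'a) \<Rightarrow> 'b :: comm_monoid_add"
  shows "(\<Sum>x\<in>PiE {..<Suc n} (\<lambda>_. V). F x) = (\<Sum>x\<in>PiE {..<n} (\<lambda>_. V). \<Sum>a\<in>V. F (x(n := a)))"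
proof -
  have inj: "inj_on (\<lambda>(a, x). x(n := a)) (V \<times> PiE {..<n} (\<lambda>_. V))"
    by (rule inj_combinator) simp
  have "(\<Sum>x\<in>PiE {..<Suc n} (\<lambda>_. V). F x)
      = (\<Sum>(a, x)\<in>V \<times> PiE {..<n} (\<lambda>_. V). F (x(n := a)))"
    by (simp only: lessThan_Suc PiE_insert_eq sum.reindex[OF inj]) (simp add: case_prod_unfold)
  also have "\<dots> = (\<Sum>a\<in>V. \<Sum>x\<in>PiE {..<n} (\<lambda>_. V). F (x(n := a)))"
    by (simp add: sum.cartesian_product)
  finally show ?thesis
    by (subst sum.swap)
qed

text \<open>With sextuples as functions on \<open>{..<6}\<close>, renaming variables is composition
  with a permutation rather than repeated exchange of nested sums.\<close>

lemma sum_PiE_6: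
  fixes F :: "'a \<Rightarrow> 'a \<Rightarrow> 'a \<Rightarrow> 'a \<Rightarrow> 'a \<Rightarrow> 'a \<Rightarrow> 'b :: comm_monoid_add"
  shows "(\<Sum>x\<in>PiE {..<6::nat} (\<lambda>_. V). F (x 0) (x 1) (x 2) (x 3) (x 4) (x 5))
    = (\<Sum>a\<in>V. \<Sum>b\<in>V. \<Sum>c\<in>V. \<Sum>d\<in>V. \<Sum>x\<in>V. \<Sum>y\<in>V. F a b c d x y)"
  proof -
  have "{..<6::nat} = {..<Suc (Suc (Suc (Suc (Suc (Suc 0)))))}"
    by (simp add: eval_nat_numeral)
  then show ?thesis
    by (simp only: sum_PiE_lessThan_Suc lessThan_0 PiE_empty_domain) simp
qed

lemma comp_permutes_PiE:
  assumes "p permutes A" "x \<in> PiE A (\<lambda>_. V)"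
  shows "x \<circ> p \<in> PiE A (\<lambda>_. V)"
proof (rule PiE_I)
  show "(x \<circ> p) i \<in> V" if "i \<in> A" for i
    using PiE_mem[OF assms(2)] permutes_in_image[OF assms(1)] that by simp
  show "(x \<circ> p) i = undefined" if "i \<notin> A" for i
    using PiE_arb[OF assms(2) that] permutes_not_in[OF assms(1) that] by simp
qed

lemma sum_PiE_permute:
  assumes "p permutes A"
  shows "(\<Sum>x\<in>PiE A (\<lambda>_. V). F (x \<circ> p)) = (\<Sum>x\<in>PiE A (\<lambda>_. V). F x)"
  by (rule sum.reindex_bij_witness[where i = "\<lambda>x. x \<circ> inv p" and j = "\<lambda>x. x \<circ> p"])
    (simp_all add: comp_assoc permutes_inv_o[OF assms] comp_permutes_PiE assms permutes_inv)

lemma sum_PiE_6_permute: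
  assumes "distinct [i0, i1, i2, i3, i4, i5]" "{i0, i1, i2, i3, i4, i5} \<subseteq> {..<6::nat}"
  shows "(\<Sum>x\<in>PiE {..<6::nat} (\<lambda>_. V). F (x i0) (x i1) (x i2) (x i3) (x i4) (x i5))
    = (\<Sum>a\<in>V. \<Sum>b\<in>V. \<Sum>c\<in>V. \<Sum>d\<in>V. \<Sum>x\<in>V. \<Sum>y\<in>V. F a b c d x y)"
proof -
  define l where "l = [i0, i1, i2, i3, i4, i5]"
  \<comment> \<open>Being the identity outside \<open>{..<6}\<close> is required by
    \<open>permutes\<close>.\<close>
  define p where "p i = (if i < 6 then l ! i else i)" for i
  have l: "distinct l" "length l = 6" "set l \<subseteq> {..<6}"
    using assms by (simp_all add: l_def)
  then have "set l = {..<6}"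
    by (intro card_subset_eq) (simp_all add: distinct_card)
  then have "bij_betw ((!) l) {..<6} {..<6}"
    using l by (intro bij_betw_nth) simp_all
  then have "bij_betw p {..<6} {..<6}"
    by (rule bij_betw_cong[THEN iffD1, rotated]) (simp add: p_def)
  then have "p permutes {..<6}"
    by (rule bij_imp_permutes) (simp add: p_def)
  then have "(\<Sum>x\<in>PiE {..<6} (\<lambda>_. V). F ((x \<circ> p) 0) ((x \<circ> p) 1) ((x \<circ> p) 2) ((x \<circ> p) 3) ((x \<circ> p) 4) ((x \<circ> p) 5))
      = (\<Sum>x\<in>PiE {..<6::nat} (\<lambda>_. V). F (x 0) (x 1) (x 2) (x 3) (x 4) (x 5))"
    by (rule sum_PiE_permute)
  moreover have "p 0 = i0" "p 1 = i1" "p 2 = i2" "p 3 = i3" "p 4 = i4" "p 5 = i5"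
    by (simp_all add: p_def l_def)
  ultimately show ?thesis
    by (simp only: o_apply sum_PiE_6)
qed

context symmetric_triples
begin

text \<open>The three coordinates other than \<open>i\<close>, \<open>j\<close>, \<open>k\<close>
  are free and contribute the factor \<open>card V ^ 3\<close>.\<close>

lemma sum_edge:
  assumes "i < 6" "j < 6" "k < 6" "i \<noteq> j" "i \<noteq> k" "j \<noteq> k"
  shows "(\<Sum>x\<in>PiE {..<6::nat} (\<lambda>_. V). of_bool (e (x i) (x j) (x k)) :: int)
    = int (card V) ^ 3 * (\<Sum>a\<in>V. \<Sum>b\<in>V. \<Sum>c\<in>V. of_bool (e a b c))"
proof -
  have "card ({..<6::nat} - {i, j, k}) = 3"
    using assms by (subst card_Diff_subset) auto
  then obtain l m n where "{..<6::nat} - {i, j, k} = {l, m, n}" "distinct [l, m, n]"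
    by (auto simp: card_3_iff)
  then have "distinct [i, j, k, l, m, n]" "{i, j, k, l, m, n} \<subseteq> {..<6::nat}"
    using assms by auto
  from sum_PiE_6_permute[OF this, of "\<lambda>a b c d x y. of_bool (e a b c) :: int" V] show ?thesis
    by (simp add: sum_distrib_left sum_distrib_right power3_eq_cube mult_ac)
qed

lemma sum_tuple_slack_le:
  "(\<Sum>x\<in>PiE {..<6::nat} (\<lambda>_. V). tuple_slack (x 0) (x 1) (x 2) (x 3) (x 4) (x 5))
    \<le> 1620 * int (card V) ^ 6 - 4320 * int (card V) ^ 3 * (\<Sum>a\<in>V. \<Sum>b\<in>V. \<Sum>c\<in>V. of_bool (e a b c))"
proof -
  let ?T = "PiE {..<6::nat} (\<lambda>_. V)"
  define B where "B = (\<Sum>a\<in>V. \<Sum>b\<in>V. \<Sum>c\<in>V. \<Sum>d\<in>V. \<Sum>x\<in>V. \<Sum>y\<in>V. book a b c d x y)"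
  define W where "W = (\<Sum>u\<in>V. \<Sum>v\<in>V. \<Sum>w\<in>V. \<Sum>x\<in>V. \<Sum>y\<in>V. \<Sum>z\<in>V. weight u v w x * weight u v y z)"
  have book: "(\<Sum>x\<in>?T. book (x i0) (x i1) (x i2) (x i3) (x i4) (x i5)) = B"
    if "distinct [i0, i1, i2, i3, i4, i5]" "{i0, i1, i2, i3, i4, i5} \<subseteq> {..<6::nat}" for i0 i1 i2 i3 i4 i5
    unfolding B_def using that by (rule sum_PiE_6_permute)
  have weight: "(\<Sum>x\<in>?T. weight (x i0) (x i1) (x i2) (x i3) * weight (x i0) (x i1) (x i4) (x i5)) = W"
    if "distinct [i0, i1, i2, i3, i4, i5]" "{i0, i1, i2, i3, i4, i5} \<subseteq> {..<6::nat}" for i0 i1 i2 i3 i4 i5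
    unfolding W_def using that by (rule sum_PiE_6_permute)
  have matching: "(\<Sum>x\<in>?T. matching (x i0) (x i1) (x i2) (x i3) (x i4) (x i5)) = 6 * B + 3 * W"
    if "distinct [i0, i1, i2, i3, i4, i5]" "{i0, i1, i2, i3, i4, i5} \<subseteq> {..<6::nat}" for i0 i1 i2 i3 i4 i5
    unfolding matching_eq sum.distrib using that by (auto simp: book weight)
  have "card ?T = card V ^ 6"
    by (simp add: card_PiE)
  then have "(\<Sum>x\<in>?T. tuple_slack (x 0) (x 1) (x 2) (x 3) (x 4) (x 5))
    = 1620 * int (card V) ^ 6
      - 216 * (20 * (int (card V) ^ 3 * (\<Sum>a\<in>V. \<Sum>b\<in>V. \<Sum>c\<in>V. of_bool (e a b c)))) - 15 * (6 * B + 3 * W)"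
    unfolding tuple_slack_eq sum_subtractf sum.distrib sum_distrib_left[symmetric]
    by (simp add: sum_edge matching)
  moreover have "B \<ge> 0" "W \<ge> 0"
    unfolding B_def W_def by (rule sum_book_nonneg, rule sum_weight_nonneg)
  ultimately show ?thesis
    by simp
qed

end

section \<open>The upper bound for relations without the two configurations\<close>

locale free_triples = symmetric_triples +
  assumes no_F32: "\<not> (e a b c \<and> e a b d \<and> e a b f \<and> e c d f)"
    and no_J4: "\<not> (e a b f \<and> e a c f \<and> e a d f \<and> e b c f \<and> e b d f \<and> e c d f)"
begin

lemma admissible: "admissible (e a b c) (e a b d) (e a c d) (e b c d) (e a b f) (e a c f)
    (e b c f) (e a d f) (e b d f) (e c d f)"
  unfolding admissible_def
  \<comment> \<open>One instance per clause, in the order of the clauses. In the instances of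
    \<open>no_J4\<close> the third term is the apex, because \<open>f\<close> is the third variable
    to occur.\<close>
  using no_F32[of a b c d f] no_F32[of a c b d f] no_F32[of b c a d f]
    no_F32[of d f a b c] no_F32[of a d b c f] no_F32[of b d a c f]
    no_F32[of c f a b d] no_F32[of c d a b f] no_F32[of b f a c d]
    no_F32[of a f b c d] no_J4[of b c a d f] no_J4[of a c b d f]
    no_J4[of a b c d f] no_J4[of a b d c f] no_J4[of a b f c d]
  by (simp only: sym conj_ac simp_thms)

definition bits :: "'a \<Rightarrow> 'a \<Rightarrow> 'a \<Rightarrow> 'a \<Rightarrow> 'a \<Rightarrow> 'a \<Rightarrow> bool list" where
  "bits a b c d x y =
    [e a b c, e a b d, e a c d, e b c d, e a b x, e a c x, e b c x, e a d x, e b d x, e c d x,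
     e a b y, e a c y, e b c y, e a d y, e b d y, e c d y, e a x y, e b x y, e c x y, e d x y]"

lemma length_bits: "length (bits a b c d x y) = 20"
  by (simp add: bits_def)

text \<open>Among all sextuples with the given slack, one of largest code is chosen; it exists
  because codes are below \<open>2 ^ 20\<close>. The five swaps preserve the slack, so none of them
  can increase this code, and the exhaustive check applies.\<close>

lemma tuple_slack_nonneg: "0 \<le> tuple_slack a b c d x y"
proof -
  let ?P = "\<lambda>(a', b', c', d', x', y'). tuple_slack a' b' c' d' x' y' = tuple_slack a b c d x y"
  let ?f = "\<lambda>(a', b', c', d', x', y'). code (bits a' b' c' d' x' y')"
  have "?P (a, b, c, d, x, y)"
    by simp
  moreover have "\<forall>t. ?P t \<longrightarrow> ?f t < 2 ^ 20"
    using code_less[of "bits _ _ _ _ _ _", unfolded length_bits] by (simp add: split_beta)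
  ultimately have "\<exists>t. ?P t \<and> (\<forall>t'. ?P t' \<longrightarrow> ?f t' \<le> ?f t)"
    by (rule ex_has_greatest_nat)
  then obtain p q r s t u where eq: "tuple_slack p q r s t u = tuple_slack a b c d x y"
    and max: "\<And>p' q' r' s' t' u'. tuple_slack p' q' r' s' t' u' = tuple_slack a b c d x y
      \<Longrightarrow> code (bits p' q' r' s' t' u') \<le> code (bits p q r s t u)"
    by (auto simp only: split_paired_Ex split_paired_All prod.case)
  have lex: "lex_ge (bits p q r s t u) (bits p' q' r' s' t' u')"
    if "tuple_slack p' q' r' s' t' u' = tuple_slack p q r s t u" for p' q' r' s' t' u'
    by (rule lex_ge_code) (simp_all only: length_bits max that eq)
  note swaps = tuple_slack_swap[THEN lex, unfolded bits_def]
  have "0 \<le> tuple_slack p q r s t u"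
    unfolding tuple_slack_def
    by (rule slack_nonneg, (rule admissible)+, insert swaps, simp_all only: sym)
  then show ?thesis
    using eq by simp
qed

lemma sum_triples_le:
  assumes "finite V"
  shows "8 * (\<Sum>a\<in>V. \<Sum>b\<in>V. \<Sum>c\<in>V. of_bool (e a b c)) \<le> 3 * int (card V) ^ 3"
proof (cases "V = {}")
  case False
  then have "0 < int (card V) ^ 3"
    using assms by (simp add: card_gt_0_iff)
  \<comment> \<open>The factor 540 cancels: 1620 = 540 * 3 and 4320 = 540 * 8, the source of the
    density 3/8.\<close>
  moreover have "0 \<le> int (card V) ^ 3 * (3 * int (card V) ^ 3 - 8 * (\<Sum>a\<in>V. \<Sum>b\<in>V. \<Sum>c\<in>V. of_bool (e a b c)))"
  proof -
    have "0 \<le> (\<Sum>x\<in>PiE {..<6::nat} (\<lambda>_. V). tuple_slack (x 0) (x 1) (x 2) (x 3) (x 4) (x 5))"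
      by (intro sum_nonneg tuple_slack_nonneg)
    also have "\<dots> \<le> 1620 * int (card V) ^ 6 - 4320 * int (card V) ^ 3 * (\<Sum>a\<in>V. \<Sum>b\<in>V. \<Sum>c\<in>V. of_bool (e a b c))"
      by (rule sum_tuple_slack_le)
    also have "int (card V) ^ 6 = int (card V) ^ 3 * int (card V) ^ 3"
      by (simp flip: power_add)
    finally show ?thesis
      by (simp add: algebra_simps)
  qed
  ultimately show ?thesis
    by (simp add: zero_le_mult_iff)
qed simp

end

section \<open>The Turan density\<close>

lemma card_orderings:
  assumes "card t = 3"
  shows "card {(a, b, c). {a, b, c} = t} = 6"
proof -
  obtain u v w where t: "t = {u, v, w}" "u \<noteq> v" "u \<noteq> w" "v \<noteq> w"
    using assms by (auto simp: card_3_iff)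
  have "{(a, b, c). {a, b, c} = t}
      = {(u, v, w), (u, w, v), (v, u, w), (v, w, u), (w, u, v), (w, v, u)}"
  proof (intro equalityI subsetI)
    fix p assume "p \<in> {(a, b, c). {a, b, c} = t}"
    then obtain a b c where p: "p = (a, b, c)" and abc: "{a, b, c} = {u, v, w}"
      using t(1) by auto
    have "card {a, b, c} = 3"
      using assms t(1) abc by simp
    then have "a \<noteq> b" "a \<noteq> c" "b \<noteq> c"
      by (auto simp: card_insert_if split: if_splits)
    moreover have "a \<in> {u, v, w}" "b \<in> {u, v, w}" "c \<in> {u, v, w}"
      unfolding abc[symmetric] by simp_all
    ultimately show "p \<in> {(u, v, w), (u, w, v), (v, u, w), (v, w, u), (w, u, v), (w, v, u)}"
      unfolding p by fast
  qed (auto simp: t(1))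
  then show ?thesis
    using t(2-4) by simp
qed

text \<open>Every edge is met in its six orders; triples with a repeated entry are never
  edges.\<close>

lemma sum_ordered_triples:
  assumes "finite V" "E \<subseteq> nsets V 3"
  shows "(\<Sum>a\<in>V. \<Sum>b\<in>V. \<Sum>c\<in>V. of_bool ({a, b, c} \<in> E)) = 6 * int (card E)"
proof -
  have fin: "finite E"
    using assms finite_imp_finite_nsets finite_subset by metis
  have E: "card t = 3" "t \<subseteq> V" if "t \<in> E" for t
    using that assms(2) by (auto simp: nsets_def)
  have "(\<Sum>a\<in>V. \<Sum>b\<in>V. \<Sum>c\<in>V. of_bool ({a, b, c} \<in> E))
      = (\<Sum>(a, b, c)\<in>V \<times> V \<times> V. of_bool ({a, b, c} \<in> E) :: int)"
    by (simp add: sum.cartesian_product)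
  also have "\<dots> = int (card ((V \<times> V \<times> V) \<inter> {(a, b, c). {a, b, c} \<in> E}))"
    using assms(1) by (simp add: case_prod_unfold Int_def)
  also have "(V \<times> V \<times> V) \<inter> {(a, b, c). {a, b, c} \<in> E} = (\<Union>t\<in>E. {(a, b, c). {a, b, c} = t})"
    using E(2) by auto
  also have "card \<dots> = (\<Sum>t\<in>E. card {(a, b, c). {a, b, c} = t})"
  proof (rule card_UN_disjoint)
    show "\<forall>t\<in>E. finite {(a, b, c). {a, b, c} = t}"
      using E(1) card_orderings by (metis card.infinite zero_neq_numeral)
  qed (use fin in auto)
  also have "\<dots> = 6 * card E"
    using E(1) by (simp add: card_orderings)
  finally show ?thesis
    by simp
qed

lemma edge_distinct:
  assumes "three_graph G" "{a, b, c} \<in> edges G"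
  shows "a \<noteq> b" "a \<noteq> c" "b \<noteq> c" "a \<in> verts G" "b \<in> verts G" "c \<in> verts G"
  using assms by (auto simp: three_graph_def nsets_def card_insert_if split: if_splits)

lemma verts_J4: "verts J4 = {1, 2, 3, 4, 5}" and verts_F32: "verts F32 = {1, 2, 3, 4, 5}"
  by (auto simp: J4_def F32_def)

lemma edges_F32: "edges F32 = {{1, 2, 3}, {1, 2, 4}, {1, 2, 5}, {3, 4, 5}}"
  by (simp add: F32_def)

lemma edges_J4:
  "edges J4 = {{1, 2, 5}, {1, 3, 5}, {1, 4, 5}, {2, 3, 5}, {2, 4, 5}, {3, 4, 5}}"
proof (intro equalityI subsetI)
  fix t assume "t \<in> edges J4"
  then obtain x y where t: "t = {x, y, 5}" and xy: "x \<noteq> y" "x \<in> {1..4}" "y \<in> {1..4}"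
    by (auto simp: J4_def)
  have "x \<in> {1, 2, 3, 4}" "y \<in> {1, 2, 3, 4}"
    using xy(2,3) by auto
  then show "t \<in> {{1, 2, 5}, {1, 3, 5}, {1, 4, 5}, {2, 3, 5}, {2, 4, 5}, {3, 4, 5}}"
    unfolding t using xy(1) by (elim insertE emptyE) (simp_all add: insert_commute)
next
  have "{x, y, 5} \<in> edges J4" if "x \<noteq> y" "x \<in> {1..4}" "y \<in> {1..4}" for x y
    unfolding J4_def using that by auto
  then show "t \<in> edges J4"
    if "t \<in> {{1, 2, 5}, {1, 3, 5}, {1, 4, 5}, {2, 3, 5}, {2, 4, 5}, {3, 4, 5}}" for t
    using that by fastforce
qed

lemma free_triples_edges:
  fixes G :: "'a hgraph"
  assumes G: "three_graph G" and free: "free_of {J4, F32} G"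
  shows "free_triples (\<lambda>a b c. {a, b, c} \<in> edges G)"
proof
  fix a b c d f :: 'a
  \<comment> \<open>The vertices of \<open>J4\<close> and \<open>F32\<close> are numbered from 1,
    list positions from 0.\<close>
  define h where "h i = [a, b, c, d, f] ! (i - 1)" for i :: nat
  have h: "h 1 = a" "h 2 = b" "h 3 = c" "h 4 = d" "h 5 = f"
    by (simp_all add: h_def)
  have copy: "contains_copy G H"
    if "verts H = {1, 2, 3, 4, 5}" "distinct [a, b, c, d, f]" "{a, b, c, d, f} \<subseteq> verts G"
      "\<forall>t\<in>edges H. h ` t \<in> edges G" for H
    unfolding contains_copy_def using that by (intro exI[of _ h]) (simp add: h del: One_nat_def)
  show "\<not> ({a, b, c} \<in> edges G \<and> {a, b, d} \<in> edges G \<and> {a, b, f} \<in> edges G \<and> {c, d, f} \<in> edges G)"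
  proof
    assume "{a, b, c} \<in> edges G \<and> {a, b, d} \<in> edges G \<and> {a, b, f} \<in> edges G \<and> {c, d, f} \<in> edges G"
    then have *: "{a, b, c} \<in> edges G" "{a, b, d} \<in> edges G" "{a, b, f} \<in> edges G" "{c, d, f} \<in> edges G"
      by simp_all
    \<comment> \<open>Any two of the five vertices lie in a common edge, so the edges alone force
      them to be distinct.\<close>
    have "contains_copy G F32"
      using * *[THEN edge_distinct(1)[OF G]] *[THEN edge_distinct(2)[OF G]] *[THEN edge_distinct(3)[OF G]]
        *[THEN edge_distinct(4)[OF G]] *[THEN edge_distinct(5)[OF G]] *[THEN edge_distinct(6)[OF G]]
      by (intro copy verts_F32) (simp_all add: edges_F32 h del: One_nat_def)
    then show False
      using free by (simp add: free_of_def)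
  qed
  show "\<not> ({a, b, f} \<in> edges G \<and> {a, c, f} \<in> edges G \<and> {a, d, f} \<in> edges G \<and>
      {b, c, f} \<in> edges G \<and> {b, d, f} \<in> edges G \<and> {c, d, f} \<in> edges G)"
  proof
    assume "{a, b, f} \<in> edges G \<and> {a, c, f} \<in> edges G \<and> {a, d, f} \<in> edges G \<and>
      {b, c, f} \<in> edges G \<and> {b, d, f} \<in> edges G \<and> {c, d, f} \<in> edges G"
    then have *: "{a, b, f} \<in> edges G" "{a, c, f} \<in> edges G" "{a, d, f} \<in> edges G"
      "{b, c, f} \<in> edges G" "{b, d, f} \<in> edges G" "{c, d, f} \<in> edges G"
      by simp_all
    have "contains_copy G J4"
      using * *[THEN edge_distinct(1)[OF G]] *[THEN edge_distinct(2)[OF G]] *[THEN edge_distinct(3)[OF G]]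
        *[THEN edge_distinct(4)[OF G]] *[THEN edge_distinct(5)[OF G]] *[THEN edge_distinct(6)[OF G]]
      by (intro copy verts_J4) (simp_all add: edges_J4 h del: One_nat_def)
    then show False
      using free by (simp add: free_of_def)
  qed
qed (simp_all add: insert_commute)

lemma edges_nonempty: "H \<in> {J4, F32} \<Longrightarrow> edges H \<noteq> {}"
  by (auto simp: edges_J4 edges_F32)

text \<open>Six orders per edge turn the bound on ordered triples into
  \<open>48 * card (edges G) \<le> 3 * n ^ 3\<close>.\<close>

lemma turan_ex_le: "16 * turan_ex n {J4, F32} \<le> n ^ 3"
proof -
  obtain G :: "nat hgraph" where G: "three_graph G" "finite (verts G)" "card (verts G) = n"
      "free_of {J4, F32} G" "card (edges G) = turan_ex n {J4, F32}"
    using turan_ex_attained edges_nonempty by blast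
  interpret free_triples "\<lambda>a b c. {a, b, c} \<in> edges G"
    using G(1,4) by (rule free_triples_edges)
  have "8 * (6 * int (card (edges G))) \<le> 3 * int n ^ 3"
    using sum_triples_le[OF G(2)] sum_ordered_triples[OF G(2)] G(1,3) by (simp add: three_graph_def)
  then have "int (16 * turan_ex n {J4, F32}) \<le> int (n ^ 3)"
    using G(5) by simp
  then show ?thesis
    by (simp only: of_nat_le_iff)
qed

section \<open>The lower bound: the complete 4-partite 3-graph whose parts are the residue classes
  modulo 4\<close>

definition four_partite :: "nat \<Rightarrow> nat hgraph" where
  "four_partite m = ({..<4 * m}, {t \<in> nsets {..<4 * m} 3. inj_on (\<lambda>x. x mod 4) t})"

text \<open>By pigeonhole two of the five vertices land in the same part, but they share an edge,
  whose image meets each part at most once.\<close>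

lemma four_partite_free:
  assumes "card (verts H) = 5"
    and cover: "\<And>i j. i \<in> verts H \<Longrightarrow> j \<in> verts H \<Longrightarrow> i \<noteq> j \<Longrightarrow> \<exists>t\<in>edges H. i \<in> t \<and> j \<in> t"
  shows "\<not> contains_copy (four_partite m) (H :: nat hgraph)"
proof
  assume "contains_copy (four_partite m) H"
  then obtain f :: "nat \<Rightarrow> nat" where f: "inj_on f (verts H)"
      "\<And>t. t \<in> edges H \<Longrightarrow> inj_on (\<lambda>x. x mod 4) (f ` t)"
    by (auto simp: contains_copy_def four_partite_def)
  have "\<not> inj_on (\<lambda>i. f i mod 4) (verts H)"
  proof
    assume "inj_on (\<lambda>i. f i mod 4) (verts H)"
    moreover have "(\<lambda>i. f i mod 4) ` (verts H) \<subseteq> {..<4}"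
      by auto
    ultimately have "card (verts H) \<le> card {..<4 :: nat}"
      by (rule card_inj_on_le) simp
    then show False
      using assms(1) by simp
  qed
  then obtain i j where ij: "i \<in> (verts H)" "j \<in> (verts H)" "i \<noteq> j" "f i mod 4 = f j mod 4"
    by (auto simp: inj_on_def)
  then obtain t where "t \<in> edges H" "i \<in> t" "j \<in> t"
    using cover by blast
  then have "f i = f j"
    using f(2)[of t] ij(4) by (auto dest: inj_onD)
  then show False
    using f(1) ij by (auto dest: inj_onD)
qed

lemma sum_mod_4: "(\<Sum>a<4 * m. F (a mod 4)) = of_nat m * (\<Sum>r<4. F r :: int)" for m :: nat
proof (induction m)
  case (Suc m)
  have "4 * Suc m = Suc (Suc (Suc (Suc (4 * m))))"
    by simp
  then have "(\<Sum>a<4 * Suc m. F (a mod 4)) = (\<Sum>a<4 * m. F (a mod 4)) +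
      F (4 * m mod 4) + F (Suc (4 * m) mod 4) + F (Suc (Suc (4 * m)) mod 4) + F (Suc (Suc (Suc (4 * m))) mod 4)"
    by (simp only: sum.lessThan_Suc)
  also have "\<dots> = (\<Sum>a<4 * m. F (a mod 4)) + (F 0 + F 1 + F 2 + F 3)"
    by (simp add: mod_Suc numeral_2_eq_2 numeral_3_eq_3)
  also have "F 0 + F 1 + F 2 + F 3 = (\<Sum>r<4. F r)"
    by (simp add: eval_nat_numeral)
  finally show ?case
    using Suc by (simp add: algebra_simps)
qed simp

lemma card_four_partite: "card (edges (four_partite m)) = 4 * m ^ 3"
proof -
  define D :: "nat \<Rightarrow> nat \<Rightarrow> nat \<Rightarrow> int" where "D p q r = of_bool (distinct [p, q, r])" for p q r
  let ?V = "{..<4 * m}"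
  have "6 * int (card (edges (four_partite m)))
      = (\<Sum>a\<in>?V. \<Sum>b\<in>?V. \<Sum>c\<in>?V. of_bool ({a, b, c} \<in> edges (four_partite m)))"
    by (rule sum_ordered_triples[symmetric]) (auto simp: four_partite_def)
  also have "\<dots> = (\<Sum>a\<in>?V. \<Sum>b\<in>?V. \<Sum>c\<in>?V. D (a mod 4) (b mod 4) (c mod 4))"
  proof (intro sum.cong refl)
    fix a b c assume "a \<in> ?V" "b \<in> ?V" "c \<in> ?V"
    then show "of_bool ({a, b, c} \<in> edges (four_partite m)) = D (a mod 4) (b mod 4) (c mod 4)"
      by (auto simp: D_def four_partite_def nsets_def card_insert_if)
  qed
  also have "\<dots> = int m * (\<Sum>p<4. int m * (\<Sum>q<4. int m * (\<Sum>r<4. D p q r)))"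
    by (simp only: sum_mod_4 sum_mod_4[of "\<lambda>q. int m * sum (D p q) {..<4}" for p]
        sum_mod_4[of "\<lambda>p. int m * (\<Sum>q<4. int m * sum (D p q) {..<4})"])
  \<comment> \<open>There are 4 * 3 * 2 = 24 ordered triples of distinct residues.\<close>
  also have "\<dots> = 24 * int m ^ 3"
    by (simp add: D_def eval_nat_numeral)
  finally have "int (card (edges (four_partite m))) = int (4 * m ^ 3)"
    by simp
  then show ?thesis
    by (simp only: of_nat_eq_iff)
qed

text \<open>Since \<open>(4 * m) ^ 3 / 16 = 4 * m ^ 3\<close>, the construction meets the upper
  bound exactly.\<close>

lemma turan_ex_4: "turan_ex (4 * m) {J4, F32} = 4 * m ^ 3"
proof (rule antisym)
  show "turan_ex (4 * m) {J4, F32} \<le> 4 * m ^ 3"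
    using turan_ex_le[of "4 * m"] by (simp add: power_mult_distrib)
  have "\<not> contains_copy (four_partite m) F32"
    by (rule four_partite_free) (auto simp: verts_F32 edges_F32)
  moreover have "\<not> contains_copy (four_partite m) J4"
    by (rule four_partite_free) (auto simp: verts_J4 edges_J4)
  ultimately have "free_of {J4, F32} (four_partite m)"
    by (simp add: free_of_def)
  then have "card (edges (four_partite m)) \<le> turan_ex (4 * m) {J4, F32}"
    by (intro turan_ex_ge) (auto simp: four_partite_def three_graph_def)
  then show "4 * m ^ 3 \<le> turan_ex (4 * m) {J4, F32}"
    by (simp add: card_four_partite)
qed

lemma of_nat_choose_3: "real (n choose 3) = real n * (real n - 1) * (real n - 2) / 6"
  by (simp add: binomial_gbinomial gbinomial_prod_rev eval_nat_numeral field_simps)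

theorem theorem5:
  shows "turan_density {J4, F32} = 3 / 8"
proof -
  let ?a = "\<lambda>n. real (turan_ex n {J4, F32}) / real (n choose 3)"
  have "?a \<longlonglongrightarrow> turan_density {J4, F32}"
    unfolding turan_density_def convergent_LIMSEQ_iff[symmetric]
    by (rule convergent_turan_density) (rule edges_nonempty)
  \<comment> \<open>The full sequence converges, so its limit can be read off along the multiples of
    4, where the extremal number is known.\<close>
  moreover have "strict_mono (\<lambda>m :: nat. 4 * m)"
    by (simp add: strict_mono_def)
  ultimately have "(?a \<circ> (\<lambda>m. 4 * m)) \<longlonglongrightarrow> turan_density {J4, F32}"
    by (rule LIMSEQ_subseq_LIMSEQ)
  moreover have "(?a \<circ> (\<lambda>m. 4 * m)) \<longlonglongrightarrow> 3 / 8"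
  proof (rule Lim_transform_eventually)
    \<comment> \<open>This is \<open>4 * m ^ 3\<close> divided by
      \<open>4 * m * (4 * m - 1) * (4 * m - 2) / 6\<close>, after cancelling powers of
      \<open>m\<close>.\<close>
    have "(\<lambda>m. 6 / ((4 - 1 / real m) * (4 - 2 / real m))) \<longlonglongrightarrow> 6 / ((4 - 0) * (4 - 0))"
      by (intro tendsto_intros lim_const_over_n) simp
    then show "(\<lambda>m. 6 / ((4 - 1 / real m) * (4 - 2 / real m))) \<longlonglongrightarrow> 3 / 8"
      by simp
    show "\<forall>\<^sub>F m in sequentially. 6 / ((4 - 1 / real m) * (4 - 2 / real m)) = (?a \<circ> (\<lambda>m. 4 * m)) m"
      using eventually_gt_at_top[of 0]
    proof eventually_elim
      case (elim m)
      then have m: "real m \<noteq> 0" "4 * real m - 1 \<noteq> 0" "4 * real m - 2 \<noteq> 0"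
        by linarith+
      have "4 - 1 / real m = (4 * real m - 1) / real m" "4 - 2 / real m = (4 * real m - 2) / real m"
        using m(1) by (simp_all add: field_simps)
      then show ?case
        unfolding o_apply turan_ex_4 of_nat_choose_3 using m by (simp add: power3_eq_cube)
    qed
  qed
  ultimately show ?thesis
    by (rule LIMSEQ_unique)
qed

end
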